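(* Let $k\ge 1$ and $r\ge 2$ be integers. Then $$g_2(k,r)=\begin{cases} r\binom{k}{\lfloor k/2\rfloor} & \text{if } k\ge 3 \text{ and } r\ne 2,\\[2pt] \binom{k}{\lfloor k/2\rfloor}+\binom{k}{\lfloor k/2+1\rfloor} & \text{if } r=2,\\[2pt] 2r-1 & \text{if } k=2.\end{cases}$$
   Context: Model 2 (non-adaptive, $r+2$ players $A,B,C_1,\dots,C_r$ with $r>1$). Player $A$ chooses an unknown defective element $d$ of a finite set $X$. A query is an ordered $r$-tuple $(X_1,\dots,X_r)$ of pairwise disjoint subsets of $X$ whose union is $X$ (a partition of $X$ into $r$ sets); Player $B$ chooses all $k$ queries at once. For each query $(X_1,\dots,X_r)$, if $d\in X_i$ then Player $C_i$ is given the set $X_i$ (i.e. a YES answer together with the set); the players $C_i$ have no other information about the queries. Player $C_i$ can identify $d$ iff $d$ is the unique element of $X$ contained in every set given to $C_i$ (if $C_i$ is given no sets, this means $X=\{d\}$). A collection of queries solves Model 2 if for every choice of $d\in X$ at least one player $C_i$ can identify $d$. $g_2(k,r)$ denotes the largest $n$ such that on an $n$-element set there are $k$ queries solving Model 2. *)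

theory Defs
  imports Main "HOL-Library.Disjoint_Sets"
begin

text \<open>
  The players \<open>C\<^sub>1, \<dots>, C\<^sub>r\<close> are indexed by \<open>{..<r}\<close>, and the \<open>k\<close> queries by \<open>{..<k}\<close>:
  \<open>Q j i\<close> is the \<open>i\<close>-th part of the \<open>j\<close>-th query. Parts of a query may be empty.
\<close>

definition is_query :: "nat \<Rightarrow> 'a set \<Rightarrow> (nat \<Rightarrow> 'a set) \<Rightarrow> bool" where
  "is_query r X P \<longleftrightarrow>
     (\<forall>i<r. P i \<subseteq> X) \<and> disjoint_family_on P {..<r} \<and> (\<Union>i<r. P i) = X"

definition given_sets :: "nat \<Rightarrow> (nat \<Rightarrow> nat \<Rightarrow> 'a set) \<Rightarrow> 'a \<Rightarrow> nat \<Rightarrow> 'a set set" where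
  "given_sets k Q d i = {Q j i | j. j < k \<and> d \<in> Q j i}"

text \<open>If player \<open>i\<close> is given no sets, the left-hand side below is all of \<open>X\<close>.\<close>

definition can_identify ::
    "nat \<Rightarrow> 'a set \<Rightarrow> (nat \<Rightarrow> nat \<Rightarrow> 'a set) \<Rightarrow> 'a \<Rightarrow> nat \<Rightarrow> bool" where
  "can_identify k X Q d i \<longleftrightarrow> {x \<in> X. \<forall>S \<in> given_sets k Q d i. x \<in> S} = {d}"

definition solves_model2 ::
    "nat \<Rightarrow> nat \<Rightarrow> 'a set \<Rightarrow> (nat \<Rightarrow> nat \<Rightarrow> 'a set) \<Rightarrow> bool" where
  "solves_model2 k r X Q \<longleftrightarrow>
     (\<forall>j<k. is_query r X (Q j)) \<and> (\<forall>d\<in>X. \<exists>i<r. can_identify k X Q d i)"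

definition solvable2 :: "nat \<Rightarrow> nat \<Rightarrow> nat \<Rightarrow> bool" where
  "solvable2 k r n \<longleftrightarrow>
     (\<exists>(X :: nat set) Q. finite X \<and> card X = n \<and> solves_model2 k r X Q)"

definition g2 :: "nat \<Rightarrow> nat \<Rightarrow> nat" where
  "g2 k r = (GREATEST n. solvable2 k r n)"

text \<open>The maximum in \<^const>\<open>g2\<close> exists, so \<^const>\<open>Greatest\<close> is well-behaved here.\<close>

lemma solvable2_bound:
  assumes "solvable2 k r n"
  shows "n \<le> 2 ^ (k * r)"
proof -
  obtain X :: "nat set" and Q where X: "finite X" "card X = n" and Q: "solves_model2 k r X Q"
    using assms unfolding solvable2_def by blast
  define f where "f d = {(j, i). j < k \<and> i < r \<and> d \<in> Q j i}" for d
  have "inj_on f X"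
  proof (rule inj_onI)
    fix d e assume d: "d \<in> X" and e: "e \<in> X" and eq: "f d = f e"
    obtain i where i: "i < r" "can_identify k X Q d i"
      using Q d unfolding solves_model2_def by blast
    have "e \<in> Q j i" if "j < k" "d \<in> Q j i" for j
    proof -
      have "(j, i) \<in> f d" using that i by (simp add: f_def)
      then show ?thesis unfolding eq by (simp add: f_def)
    qed
    then have "e \<in> {x \<in> X. \<forall>S \<in> given_sets k Q d i. x \<in> S}"
      using e unfolding given_sets_def by blast
    then show "d = e" using i unfolding can_identify_def by simp
  qed
  moreover have "f ` X \<subseteq> Pow ({..<k} \<times> {..<r})" by (auto simp: f_def)
  ultimately have "card X \<le> card (Pow ({..<k} \<times> {..<r}))"
    by (intro card_inj_on_le) auto
  then show ?thesis using X by (simp add: card_Pow card_cartesian_product)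
qed

lemma solvable2_0: "solvable2 k r 0"
  unfolding solvable2_def solves_model2_def is_query_def
  by (intro exI[of _ "{}"] exI[of _ "\<lambda>_ _. {}"]) (auto simp: disjoint_family_on_def)

lemma solvable2_g2: "solvable2 k r (g2 k r)"
  unfolding g2_def by (rule GreatestI_nat[where P = "solvable2 k r", OF solvable2_0]) (rule solvable2_bound)

lemma solvable2_le_g2: "solvable2 k r n \<Longrightarrow> n \<le> g2 k r"
  unfolding g2_def by (rule Greatest_le_nat) (auto intro: solvable2_bound)

end

theory Submission
  imports Defs Complex_Main
begin

text \<open>
  An element \<open>x\<close> is encoded by the word whose \<open>j\<close>-th letter is the index of the part of the
  \<open>j\<close>-th query containing \<open>x\<close>. Player \<open>i\<close> identifies \<open>d\<close> iff the set of positions of the letter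
  \<open>i\<close> in the word of \<open>d\<close> is contained in that of no other word. Hence the elements identified by
  a fixed player form an antichain of subsets of \<open>{..<k}\<close>, and Sperner's theorem gives the bound
  for \<open>r > 2\<close>; it is attained by words in which one letter occurs exactly \<open>\<lceil>k/2\<rceil>\<close> times and all
  others less often. For \<open>r = 2\<close> the two letters have complementary position sets, so one gets a
  union of two antichains, which the LYM inequality bounds by the two largest levels. For
  \<open>k = 2\<close> words are edges of a bipartite graph on \<open>r + r\<close> vertices in which every edge not joining
  two copies of the same letter has an endpoint of degree one. Charging each edge to such an
  endpoint (and an edge joining two copies of a letter to the first copy) is injective and misses
  a vertex, which leaves \<open>2 r - 1\<close> edges; a double star attains this.
\<close>

section \<open>Antichains of finite sets\<close>

definition antichain :: "'a set set \<Rightarrow> bool" where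
  "antichain F \<longleftrightarrow> (\<forall>A\<in>F. \<forall>B\<in>F. A \<subseteq> B \<longrightarrow> A = B)"

lemma antichain_subset: "antichain F \<Longrightarrow> G \<subseteq> F \<Longrightarrow> antichain G"
  unfolding antichain_def by blast

text \<open>
  Induction on \<open>card S\<close>: for \<open>S \<notin> F\<close> the sum is the average over \<open>x \<in> S\<close> of the sums belonging
  to the antichains \<open>{A \<in> F. x \<notin> A}\<close> in \<open>S - {x}\<close>.
\<close>
lemma LYM_inequality:
  assumes "finite S" "F \<subseteq> Pow S" "antichain F"
  shows "(\<Sum>A\<in>F. 1 / real (card S choose card A)) \<le> 1"
  using assms
proof (induction "card S" arbitrary: S F)
  case 0
  then have "S = {}" by simp
  then have "F = {} \<or> F = {{}}" using 0 by (simp add: subset_singleton_iff)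
  then show ?case using \<open>S = {}\<close> by auto
next
  case (Suc n S F)
  have finF: "finite F" using Suc.prems finite_subset by auto
  show ?case
  proof (cases "S \<in> F")
    case True
    then have "F = {S}" using Suc.prems unfolding antichain_def by blast
    then show ?thesis by simp
  next
    case False
    have step: "(\<Sum>A | A \<in> F \<and> x \<notin> A. 1 / real (n choose card A)) \<le> 1" if "x \<in> S" for x
    proof -
      have "card (S - {x}) = n" using that Suc.hyps(2) Suc.prems(1) by simp
      moreover have "{A \<in> F. x \<notin> A} \<subseteq> Pow (S - {x})" using Suc.prems(2) by blast
      moreover have "antichain {A \<in> F. x \<notin> A}"
        using Suc.prems(3) by (rule antichain_subset) blast
      ultimately show ?thesis using Suc.hyps(1)[of "S - {x}"] Suc.prems(1) by simp
    qed
    \<comment> \<open>All \<open>Suc n - card A\<close> points outside \<open>A\<close> contribute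
      equally, so this is the absorption identity (n+1-a) C(n+1,a) = (n+1) C(n,a) for a =
      \<open>card A\<close>.\<close>
    have weight: "real (Suc n) * (1 / real (Suc n choose card A)) =
        (\<Sum>x | x \<in> S \<and> x \<notin> A. 1 / real (n choose card A))" if "A \<in> F" for A
    proof -
      have "A \<subset> S" using that False Suc.prems(2) by blast
      then have lt: "card A < Suc n" using Suc.hyps(2) Suc.prems(1) psubset_card_mono by metis
      have "{x. x \<in> S \<and> x \<notin> A} = S - A" by blast
      then have c: "card {x. x \<in> S \<and> x \<notin> A} = Suc n - card A"
        using \<open>A \<subset> S\<close> Suc.hyps(2) Suc.prems(1) card_Diff_subset[of A S] finite_subset[of A S]
        by simp
      have "(Suc n - card A) * (Suc n choose card A) = Suc n * (n choose card A)"
        using binomial_absorb_comp[of "Suc n" "card A"] by simp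
      then have "real (Suc n - card A) * real (Suc n choose card A)
          = real (Suc n) * real (n choose card A)"
        by (metis of_nat_mult)
      moreover have "0 < n choose card A" "0 < Suc n choose card A" using lt by simp_all
      ultimately show ?thesis unfolding sum_constant c by (simp add: field_simps del: binomial_Suc_Suc)
    qed
    have "real (Suc n) * (\<Sum>A\<in>F. 1 / real (Suc n choose card A)) =
        (\<Sum>A\<in>F. \<Sum>x | x \<in> S \<and> x \<notin> A. 1 / real (n choose card A))"
      unfolding sum_distrib_left by (rule sum.cong[OF refl weight])
    also have "\<dots> = (\<Sum>x\<in>S. \<Sum>A | A \<in> F \<and> x \<notin> A. 1 / real (n choose card A))"
      by (rule sum.swap_restrict[OF finF Suc.prems(1)])
    also have "\<dots> \<le> (\<Sum>x\<in>S. 1)" by (rule sum_mono) (rule step)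
    also have "\<dots> = real (Suc n) * 1" using Suc.hyps(2) by simp
    finally show ?thesis unfolding Suc.hyps(2)[symmetric]
      by (rule mult_left_le_imp_le) simp
  qed
qed

text \<open>Every term of the LYM sum is at least the reciprocal of the central binomial
  coefficient.\<close>

theorem Sperner:
  assumes "finite S" "F \<subseteq> Pow S" "antichain F"
  shows "card F \<le> card S choose (card S div 2)"
proof -
  let ?M = "card S choose (card S div 2)"
  have pos: "0 < ?M" by simp
  have "real (card F) / real ?M = (\<Sum>A\<in>F. 1 / real ?M)" by simp
  also have "\<dots> \<le> (\<Sum>A\<in>F. 1 / real (card S choose card A))"
  proof (rule sum_mono)
    fix A assume "A \<in> F"
    then have "card A \<le> card S" using assms by (auto intro: card_mono)
    then show "1 / real ?M \<le> 1 / real (card S choose card A)"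
      by (intro divide_left_mono) (simp_all add: binomial_maximum)
  qed
  also have "\<dots> \<le> 1" by (rule LYM_inequality[OF assms])
  finally show ?thesis using pos by (simp add: divide_simps)
qed

text \<open>Binomial coefficients decrease beyond the middle; an \<open>a\<close> below the middle
  is first reflected to \<open>n - a\<close>, which is at least \<open>n div 2 + 1\<close>.\<close>

lemma binomial_le_second_largest:
  assumes "a \<le> n" "a \<noteq> n div 2"
  shows "n choose a \<le> n choose (n div 2 + 1)"
proof (cases "n div 2 < a")
  case True
  then show ?thesis using assms by (intro binomial_antimono) auto
next
  case False
  then have "n choose (n - a) \<le> n choose (n div 2 + 1)"
    using assms by (intro binomial_antimono) linarith+
  then show ?thesis using assms binomial_symmetric by metis
qed

text \<open>Let M and N be the two coefficients of the bound. By LYM the union has total weight at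
  most 2. Sets of size \<open>n div 2\<close> weigh 1/M and number at most M; every other set weighs
  at least 1/N. The count is largest when the whole middle level is taken, leaving weight 1 and
  hence at most N other sets.\<close>

theorem two_antichains_card_le:
  assumes S: "finite S" "S \<noteq> {}" and sub: "F \<subseteq> Pow S" "G \<subseteq> Pow S"
    and anti: "antichain F" "antichain G"
  shows "card (F \<union> G) \<le> (card S choose (card S div 2)) + (card S choose (card S div 2 + 1))"
proof -
  define n where "n = card S"
  define M N where "M = n choose (n div 2)" and "N = n choose (n div 2 + 1)"
  define P where "P = {A \<in> F \<union> G. card A = n div 2}"
  define R where "R = {A \<in> F \<union> G. card A \<noteq> n div 2}"
  have n: "0 < n" using S by (simp add: n_def card_gt_0_iff)
  have fin: "finite F" "finite G" using S(1) sub by (simp_all add: finite_subset[of _ "Pow S"])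
  have finPR: "finite P" "finite R" using fin by (auto simp: P_def R_def)
  have FG: "F \<union> G = P \<union> R" "P \<inter> R = {}" by (auto simp: P_def R_def)
  have M: "0 < M" and N: "0 < N" and NM: "N \<le> M"
    using n by (simp_all add: M_def N_def binomial_maximum)
  have P_le: "card P \<le> M"
  proof -
    have "P \<subseteq> {A. A \<subseteq> S \<and> card A = n div 2}" using sub by (auto simp: P_def)
    then have "card P \<le> card {A. A \<subseteq> S \<and> card A = n div 2}"
      using S by (intro card_mono) auto
    then show ?thesis using S by (simp add: n_subsets M_def n_def)
  qed
  let ?f = "\<lambda>A. 1 / real (n choose card A)"
  have "real (card P) / real M + real (card R) / real N
      = (\<Sum>A\<in>P. 1 / real M) + (\<Sum>A\<in>R. 1 / real N)" by simp
  also have "\<dots> \<le> sum ?f P + sum ?f R"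
  proof (rule add_mono)
    show "(\<Sum>A\<in>P. 1 / real M) \<le> sum ?f P"
      by (rule sum_mono) (simp add: P_def M_def)
    show "(\<Sum>A\<in>R. 1 / real N) \<le> sum ?f R"
    proof (rule sum_mono)
      fix A assume A: "A \<in> R"
      then have le: "card A \<le> n" using S sub by (auto simp: R_def n_def intro: card_mono)
      have "n choose card A \<le> N"
        unfolding N_def using A le by (intro binomial_le_second_largest) (auto simp: R_def)
      moreover have "0 < n choose card A" using le by simp
      ultimately show "1 / real N \<le> ?f A" by (intro divide_left_mono) (use N in auto)
    qed
  qed
  also have "\<dots> = sum ?f (F \<union> G)"
    unfolding FG(1) by (rule sum.union_disjoint[symmetric, OF finPR FG(2)])
  also have "\<dots> \<le> sum ?f F + sum ?f G"
    unfolding sum.union_inter[OF fin, symmetric] by (simp add: sum_nonneg)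
  also have "\<dots> \<le> 2"
    using LYM_inequality[OF S(1) sub(1) anti(1)] LYM_inequality[OF S(1) sub(2) anti(2)]
    by (simp add: n_def)
  finally have "real (card P) / real M + real (card R) / real N \<le> 2" .
  \<comment> \<open>With p = \<open>card P\<close> and q = \<open>card R\<close>, solving for q and
    adding p gives the bound 2N + (p/M)(M - N). It grows with p because N \<le> M, so p \<le> M
    yields M + N.\<close>
  then have "real (card R) \<le> real N * (2 - real (card P) / real M)"
    using N by (simp add: field_simps)
  then have "real (card P) + real (card R)
      \<le> 2 * real N + (real (card P) / real M) * (real M - real N)"
    using M by (simp add: field_simps)
  also have "\<dots> \<le> 2 * real N + 1 * (real M - real N)"
    using P_le M NM by (intro add_left_mono mult_right_mono) (simp_all add: divide_simps)
  finally have "card P + card R \<le> M + N" by simp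
  then show ?thesis
    using card_Un_disjoint[OF finPR FG(2)] FG(1) by (simp add: M_def N_def n_def)
qed

section \<open>Words\<close>

definition positions :: "nat \<Rightarrow> (nat \<Rightarrow> nat) \<Rightarrow> nat \<Rightarrow> nat set" where
  "positions k v i = {j. j < k \<and> v j = i}"

lemma positions_subset: "positions k v i \<subseteq> {..<k}"
  by (auto simp: positions_def)

definition identifies :: "nat \<Rightarrow> 'a set \<Rightarrow> ('a \<Rightarrow> nat \<Rightarrow> nat) \<Rightarrow> 'a \<Rightarrow> nat \<Rightarrow> bool" where
  "identifies k X w d i \<longleftrightarrow>
     (\<forall>x\<in>X. positions k (w d) i \<subseteq> positions k (w x) i \<longrightarrow> x = d)"

definition solving_words :: "nat \<Rightarrow> nat \<Rightarrow> 'a set \<Rightarrow> ('a \<Rightarrow> nat \<Rightarrow> nat) \<Rightarrow> bool" where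
  "solving_words k r X w \<longleftrightarrow>
     (\<forall>x\<in>X. \<forall>j<k. w x j < r) \<and> (\<forall>d\<in>X. \<exists>i<r. identifies k X w d i)"

text \<open>Player \<open>i\<close> receives the parts \<open>Q j i\<close> with \<open>j\<close> in
  \<open>positions k (w d) i\<close>, and \<open>x\<close> lies in all of them iff its own position
  set contains this one. An empty position set leaves all of \<open>X\<close> on both sides.\<close>

lemma can_identify_iff_identifies:
  assumes Q: "\<And>x j i. x \<in> X \<Longrightarrow> j < k \<Longrightarrow> i < r \<Longrightarrow> x \<in> Q j i \<longleftrightarrow> w x j = i"
    and d: "d \<in> X" and i: "i < r"
  shows "can_identify k X Q d i \<longleftrightarrow> identifies k X w d i"
proof -
  have "{x \<in> X. \<forall>S\<in>given_sets k Q d i. x \<in> S}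
      = {x \<in> X. positions k (w d) i \<subseteq> positions k (w x) i}"
    using Q d i unfolding given_sets_def positions_def by blast
  then show ?thesis using d unfolding can_identify_def identifies_def by blast
qed

text \<open>Covering provides a letter at each position, and disjointness makes it the only
  one.\<close>

lemma solves_model2_imp_solving_words:
  assumes "solves_model2 k r X Q"
  obtains w where "solving_words k r X w"
proof -
  have query: "is_query r X (Q j)" if "j < k" for j
    using assms that by (simp add: solves_model2_def)
  have "\<exists>i<r. x \<in> Q j i" if "x \<in> X" "j < k" for x j
    using query[OF that(2)] that(1) unfolding is_query_def by blast
  then obtain w where w: "\<And>x j. x \<in> X \<Longrightarrow> j < k \<Longrightarrow> w x j < r \<and> x \<in> Q j (w x j)"
    by metis
  have iff: "x \<in> Q j i \<longleftrightarrow> w x j = i" if "x \<in> X" "j < k" "i < r" for x j i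
    using query[OF that(2)] w[OF that(1,2)] that(3)
    unfolding is_query_def disjoint_family_on_def by blast
  have "can_identify k X Q d i \<longleftrightarrow> identifies k X w d i" if "d \<in> X" "i < r" for d i
    by (rule can_identify_iff_identifies[OF iff that])
  then have "\<exists>i<r. identifies k X w d i" if "d \<in> X" for d
    using assms that unfolding solves_model2_def by metis
  then show thesis using w by (intro that[of w]) (simp add: solving_words_def)
qed

lemma solving_words_imp_solves_model2:
  assumes "solving_words k r X w"
  shows "solves_model2 k r X (\<lambda>j i. {x \<in> X. w x j = i})" (is "solves_model2 k r X ?Q")
proof -
  have "is_query r X (?Q j)" if "j < k" for j
    using assms that
    by (auto simp: is_query_def solving_words_def disjoint_family_on_def)
  moreover have "can_identify k X ?Q d i \<longleftrightarrow> identifies k X w d i" if "d \<in> X" "i < r" for d i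
    using that by (intro can_identify_iff_identifies) auto
  ultimately show ?thesis using assms unfolding solves_model2_def solving_words_def by blast
qed

lemma solvable2_obtain_words:
  assumes "solvable2 k r n"
  obtains X :: "nat set" and w where "finite X" "card X = n" "solving_words k r X w"
  using assms solves_model2_imp_solving_words unfolding solvable2_def by metis

text \<open>Reindexing along a bijection lets the constructions use sets or pairs as elements,
  although \<open>solvable2\<close> asks for a set of naturals.\<close>

lemma solving_words_imp_solvable2:
  fixes Y :: "'b set"
  assumes fin: "finite Y" and w: "solving_words k r Y w"
  shows "solvable2 k r (card Y)"
proof -
  obtain h where h: "bij_betw h {..<card Y} Y"
    using ex_bij_betw_nat_finite[OF fin] by (auto simp: atLeast0LessThan)
  have img: "h ` {..<card Y} = Y" and inj: "inj_on h {..<card Y}"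
    using h by (simp_all add: bij_betw_def)
  have "solving_words k r {..<card Y} (w \<circ> h)"
    unfolding solving_words_def
  proof (intro conjI ballI)
    fix d assume d: "d \<in> {..<card Y}"
    then have "h d \<in> Y" using img by blast
    then obtain i where i: "i < r" "identifies k Y w (h d) i"
      using w unfolding solving_words_def by blast
    have "x = d" if "x \<in> {..<card Y}"
      "positions k ((w \<circ> h) d) i \<subseteq> positions k ((w \<circ> h) x) i" for x
    proof -
      have "h x \<in> Y" using that(1) img by blast
      then have "h x = h d" using i(2) that(2) unfolding identifies_def by simp
      then show ?thesis using inj that(1) d by (simp add: inj_on_def)
    qed
    then show "\<exists>i<r. identifies k {..<card Y} (w \<circ> h) d i"
      using i(1) unfolding identifies_def by blast
  next
    fix x assume "x \<in> {..<card Y}"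
    then have "h x \<in> Y" using img by blast
    then show "\<forall>j<k. (w \<circ> h) x j < r" using w by (simp add: solving_words_def)
  qed
  then have "solves_model2 k r {..<card Y} (\<lambda>j i. {x \<in> {..<card Y}. (w \<circ> h) x j = i})"
    by (rule solving_words_imp_solves_model2)
  moreover have "finite {..<card Y}" "card {..<card Y} = card Y" by simp_all
  ultimately show ?thesis unfolding solvable2_def by blast
qed

text \<open>If the position set of an identified \<open>d\<close> lies in that of some
  \<open>x\<close> in \<open>X\<close>, then \<open>x = d\<close>. Equal sets thus give injectivity,
  and inclusions the antichain property.\<close>

lemma identified_positions:
  assumes "\<And>d. d \<in> D \<Longrightarrow> d \<in> X \<and> identifies k X w d i"
  shows "inj_on (\<lambda>d. positions k (w d) i) D" "antichain ((\<lambda>d. positions k (w d) i) ` D)"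
  using assms unfolding inj_on_def antichain_def identifies_def by blast+

section \<open>Upper bounds\<close>

lemma solving_words_card_le:
  assumes w: "solving_words k r X w"
  shows "card X \<le> r * (k choose (k div 2))"
proof -
  define D where "D i = {d \<in> X. identifies k X w d i}" for i
  have "card (D i) \<le> k choose (k div 2)" for i
  proof -
    let ?P = "\<lambda>d. positions k (w d) i"
    have D: "\<And>d. d \<in> D i \<Longrightarrow> d \<in> X \<and> identifies k X w d i" by (simp add: D_def)
    have "card (D i) = card (?P ` D i)" by (rule card_image[symmetric, OF identified_positions(1)[OF D]])
    also have "\<dots> \<le> card {..<k} choose (card {..<k} div 2)"
      using identified_positions(2)[of "D i", OF D] positions_subset by (intro Sperner) blast+
    finally show ?thesis by simp
  qed
  then have "(\<Sum>i<r. card (D i)) \<le> (\<Sum>i<r. k choose (k div 2))" by (intro sum_mono)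
  moreover have "X = (\<Union>i<r. D i)" using w by (auto simp: D_def solving_words_def)
  ultimately show ?thesis using card_UN_le[of "{..<r}" D] by simp
qed

lemma solving_words_two_letters_card_le:
  assumes w: "solving_words k 2 X w" and k: "1 \<le> k"
  shows "card X \<le> (k choose (k div 2)) + (k choose (k div 2 + 1))"
proof -
  define D where "D i = {d \<in> X. identifies k X w d i}" for i :: nat
  let ?P = "\<lambda>i d. positions k (w d) i"
  have D: "\<And>i d. d \<in> D i \<Longrightarrow> d \<in> X \<and> identifies k X w d i" by (simp add: D_def)
  have X: "X = D 0 \<union> D 1"
    using w by (auto simp: D_def solving_words_def less_2_cases_iff)
  have compl: "?P 1 d = {..<k} - ?P 0 d" if "d \<in> X" for d
  proof -
    have "\<forall>j<k. w d j < 2" using w that by (simp add: solving_words_def)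
    then show ?thesis by (auto simp: positions_def less_2_cases_iff)
  qed
  \<comment> \<open>Complementation reverses inclusion, so the antichain of player 1 remains one
    when described by positions of the letter 0.\<close>
  have sub_iff: "?P 1 d \<subseteq> ?P 1 x \<longleftrightarrow> ?P 0 x \<subseteq> ?P 0 d" if "d \<in> X" "x \<in> X" for d x
    unfolding compl[OF that(1)] compl[OF that(2)]
    using positions_subset[of k "w d" 0] positions_subset[of k "w x" 0] by blast
  have anti1: "antichain (?P 0 ` D 1)"
    unfolding antichain_def
  proof (intro ballI impI)
    fix A B assume "A \<in> ?P 0 ` D 1" "B \<in> ?P 0 ` D 1" and AB: "A \<subseteq> B"
    then obtain x d where "x \<in> D 1" "d \<in> D 1" and xd: "A = ?P 0 x" "B = ?P 0 d" by blast
    then have "x = d" using D AB sub_iff[of d x] unfolding identifies_def by blast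
    then show "A = B" using xd by simp
  qed
  \<comment> \<open>Injectivity is needed across both classes: the positions of 0 determine those of
    1, so whichever player identifies \<open>x\<close> cannot separate it from
    \<open>y\<close>.\<close>
  have inj: "inj_on (?P 0) X"
  proof (rule inj_onI)
    fix x y assume xy: "x \<in> X" "y \<in> X" "?P 0 x = ?P 0 y"
    then have "?P 1 x = ?P 1 y" using compl by simp
    then show "x = y" using xy X unfolding D_def identifies_def by blast
  qed
  have "card X = card (?P 0 ` D 0 \<union> ?P 0 ` D 1)"
    using card_image[OF inj] X by (simp add: image_Un)
  also have "\<dots> \<le> (card {..<k} choose (card {..<k} div 2)) + (card {..<k} choose (card {..<k} div 2 + 1))"
  proof (rule two_antichains_card_le)
    show "antichain (?P 0 ` D 0)" by (rule identified_positions(2)[OF D])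
    show "{..<k} \<noteq> {}" using k by (auto simp: lessThan_empty_iff)
  qed (use positions_subset anti1 in blast)+
  finally show ?thesis by simp
qed

lemma positions_2_subset_iff:
  "positions 2 u i \<subseteq> positions 2 v i \<longleftrightarrow> (u 0 = i \<longrightarrow> v 0 = i) \<and> (u 1 = i \<longrightarrow> v 1 = i)"
  by (auto simp: positions_def less_2_cases_iff)

lemma solving_words_two_queries_card_le:
  assumes fin: "finite X" and w: "solving_words 2 r X w" and r: "1 \<le> r"
  shows "card X \<le> 2 * r - 1"
proof (cases "card X \<le> 1")
  case True
  then show ?thesis using r by linarith
next
  case False
  then have other: "\<exists>x\<in>X. x \<noteq> d" for d
    using card_le_Suc0_iff_eq[OF fin] unfolding One_nat_def by metis
  \<comment> \<open>\<open>unique j d\<close> says that the endpoint of the edge \<open>d\<close> on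
    side \<open>j\<close> has degree one; \<open>p d\<close> is the vertex, a pair of side and
    letter, to which \<open>d\<close> is charged.\<close>
  define unique where "unique j d \<longleftrightarrow> (\<forall>x\<in>X. w x j = w d j \<longrightarrow> x = d)" for j d
  define p where "p d = (if w d 0 = w d 1 \<or> unique 0 d then (0::nat, w d 0) else (1, w d 1))" for d
  have lt: "w d 0 < r" "w d 1 < r" if "d \<in> X" for d
    using w that by (auto simp: solving_words_def)
  have ident: "\<exists>i. \<forall>x\<in>X. (w d 0 = i \<longrightarrow> w x 0 = i) \<and> (w d 1 = i \<longrightarrow> w x 1 = i) \<longrightarrow> x = d"
    if "d \<in> X" for d
    using w that unfolding solving_words_def identifies_def positions_2_subset_iff by blast
  have words_inj: "x = d" if "d \<in> X" "x \<in> X" "w x 0 = w d 0" "w x 1 = w d 1" for x d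
    using ident[OF that(1)] that by metis
  \<comment> \<open>Since \<open>X\<close> has another element, the identifying player must occur as
    a letter of \<open>d\<close>. If it occurs twice the letters agree; if once, the endpoint there
    has degree one.\<close>
  have cases: "w d 0 = w d 1 \<or> unique 0 d \<or> unique 1 d" if "d \<in> X" for d
    using ident[OF that] other[of d] unfolding unique_def by metis
  have inj: "inj_on p X"
  proof (rule inj_onI)
    fix x y assume x: "x \<in> X" and y: "y \<in> X" and eq: "p x = p y"
    show "x = y"
    proof (cases "w x 0 = w x 1 \<or> unique 0 x")
      case True
      then have "w y 0 = w y 1 \<or> unique 0 y" and first: "w x 0 = w y 0"
        using eq unfolding p_def by (auto split: if_splits)
      \<comment> \<open>Two edges charged to the same vertex of side 0 either both join copies of
        one letter, hence have equal words, or one of them is the only edge at that vertex.\<close>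
      then consider "w x 0 = w x 1" "w y 0 = w y 1" | "unique 0 x" | "unique 0 y"
        using True by blast
      then show ?thesis
      proof cases
        case 1
        then show ?thesis using words_inj[OF y x] first by metis
      next
        case 2
        then show ?thesis using first y unfolding unique_def by metis
      next
        case 3
        then show ?thesis using first x unfolding unique_def by metis
      qed
    next
      case False
      then have "w x 1 = w y 1" using eq unfolding p_def by (auto split: if_splits)
      moreover have "unique 1 x" using False cases[OF x] by blast
      ultimately show ?thesis using y unfolding unique_def by simp
    qed
  qed
  \<comment> \<open>An edge joining two copies of a letter is preferred; if there is none, any edge
    serves as \<open>d\<close>.\<close>
  obtain d where d: "d \<in> X" "\<And>x. x \<in> X \<Longrightarrow> w x 0 = w x 1 \<Longrightarrow> w d 0 = w d 1"
    using other by metis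
  \<comment> \<open>If some \<open>y\<close> is charged to the endpoint of \<open>d\<close> on side
    1, then \<open>y = d\<close> and its letters differ, so by the choice of \<open>d\<close> no
    edge has equal letters. An edge charged to the other endpoint would then be alone there and
    equal \<open>d\<close>, contradicting the charge of \<open>y\<close> to side 1.\<close>
  have disj: "(0, w d 0) \<notin> p ` X \<or> (1, w d 1) \<notin> p ` X"
  proof (rule ccontr)
    assume "\<not> ?thesis"
    then obtain x y where xy: "x \<in> X" "y \<in> X" "p x = (0, w d 0)" "p y = (1, w d 1)"
      by (metis imageE)
    then have y: "\<not> (w y 0 = w y 1 \<or> unique 0 y)" "w y 1 = w d 1"
      unfolding p_def by (auto split: if_splits)
    then have "d = y" using cases[OF xy(2)] d(1) unfolding unique_def by metis
    moreover have "w x 0 = w x 1 \<or> unique 0 x" "w x 0 = w d 0"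
      using xy(3) unfolding p_def by (auto split: if_splits)
    ultimately show False using y(1) d xy(1) unfolding unique_def by metis
  qed
  have "p ` X \<subset> {..<2} \<times> {..<r}"
  proof
    show "p ` X \<subseteq> {..<2} \<times> {..<r}" using lt by (auto simp: p_def)
    have "(0, w d 0) \<in> {..<2::nat} \<times> {..<r}" "(1, w d 1) \<in> {..<2::nat} \<times> {..<r}"
      using lt[OF d(1)] by simp_all
    then show "p ` X \<noteq> {..<2} \<times> {..<r}" using disj by metis
  qed
  then have "card (p ` X) < card ({..<2::nat} \<times> {..<r})" by (intro psubset_card_mono) auto
  then show ?thesis using card_image[OF inj] by (simp add: card_cartesian_product)
qed

section \<open>Constructions\<close>

text \<open>The words are the two middle levels, with letter 0 on the set and 1 off it. Player 1
  identifies sets of size \<open>m\<close>, as the family contains no proper subsets of them; player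
  0 identifies sets of size \<open>m + 1\<close>, as it contains no proper supersets.\<close>

lemma two_letters_solvable:
  "solvable2 k 2 ((k choose (k div 2)) + (k choose (k div 2 + 1)))"
proof -
  define m where "m = k div 2"
  define L where "L a = {A. A \<subseteq> {..<k} \<and> card A = a}" for a
  define w :: "nat set \<Rightarrow> nat \<Rightarrow> nat" where "w A j = (if j \<in> A then 0 else 1)" for A j
  have pos: "positions k (w A) 0 = A" "positions k (w A) 1 = {..<k} - A" if "A \<subseteq> {..<k}" for A
    using that by (auto simp: positions_def w_def)
  have fin: "finite (L a)" for a unfolding L_def by (rule finite_subset[of _ "Pow {..<k}"]) auto
  have sub: "A \<subseteq> {..<k}" "finite A" if "A \<in> L m \<union> L (m + 1)" for A
    using that finite_subset by (auto simp: L_def)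
  have "solving_words k 2 (L m \<union> L (m + 1)) w"
    unfolding solving_words_def
  proof (intro conjI ballI)
    fix A assume A: "A \<in> L m \<union> L (m + 1)"
    show "\<exists>i<2. identifies k (L m \<union> L (m + 1)) w A i"
    proof (cases "card A = m")
      case True
      have "B = A" if B: "B \<in> L m \<union> L (m + 1)"
        and "positions k (w A) 1 \<subseteq> positions k (w B) 1" for B
      proof -
        have "B \<subseteq> A" using that(2) sub(1)[OF B] pos(2)[OF sub(1)[OF A]] pos(2)[OF sub(1)[OF B]] by blast
        moreover have "card A \<le> card B" using B True by (auto simp: L_def)
        ultimately show ?thesis by (rule card_seteq[OF sub(2)[OF A]])
      qed
      then have "identifies k (L m \<union> L (m + 1)) w A 1" by (simp add: identifies_def)
      then show ?thesis by (intro exI[of _ 1]) simp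
    next
      case False
      then have cA: "card A = m + 1" using A by (auto simp: L_def)
      have "B = A" if B: "B \<in> L m \<union> L (m + 1)"
        and "positions k (w A) 0 \<subseteq> positions k (w B) 0" for B
      proof -
        have "A \<subseteq> B" using that(2) pos(1)[OF sub(1)[OF A]] pos(1)[OF sub(1)[OF B]] by simp
        moreover have "card B \<le> card A" using B cA by (auto simp: L_def)
        ultimately show ?thesis by (rule card_seteq[OF sub(2)[OF B], symmetric])
      qed
      then have "identifies k (L m \<union> L (m + 1)) w A 0" by (simp add: identifies_def)
      then show ?thesis by (intro exI[of _ 0]) simp
    qed
  qed (simp add: w_def)
  moreover have "card (L m \<union> L (m + 1)) = (k choose m) + (k choose (m + 1))"
  proof -
    have "L m \<inter> L (m + 1) = {}" by (auto simp: L_def)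
    then have "card (L m \<union> L (m + 1)) = card (L m) + card (L (m + 1))"
      using fin by (intro card_Un_disjoint)
    then show ?thesis unfolding L_def by (simp add: n_subsets)
  qed
  ultimately show ?thesis
    using solving_words_imp_solvable2[of "L m \<union> L (m + 1)" k 2 w] fin by (simp add: m_def)
qed

lemma many_letters_solvable:
  assumes k: "3 \<le> k" and r: "3 \<le> r"
  shows "solvable2 k r (r * (k choose (k div 2)))"
proof -
  define m where "m = k - k div 2"
  define L where "L = {S. S \<subseteq> {..<k} \<and> card S = m}"
  \<comment> \<open>Two distinct filler letters different from \<open>i\<close>, available because
    \<open>r\<close> is at least 3. The first position outside \<open>S\<close> gets
    \<open>a i\<close>, the others get \<open>b i\<close>.\<close>
  define a b :: "nat \<Rightarrow> nat" where
    "a i = (if i = 0 then 1 else 0)" and "b i = (if i \<le> 1 then 2 else 1)" for i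
  define w :: "nat \<times> nat set \<Rightarrow> nat \<Rightarrow> nat" where
    "w = (\<lambda>(i, S) j. if j \<in> S then i else if j = Min ({..<k} - S) then a i else b i)"
  have ab: "a i \<noteq> i" "b i \<noteq> i" "a i \<noteq> b i" "a i < r" "b i < r" for i
    using r by (auto simp: a_def b_def)
  have own: "positions k (w (i, S)) i = S" if "S \<in> L" for i S
    using that ab[of i] by (auto simp: L_def positions_def w_def)
  have small: "card (positions k (w (i, S)) i') < m" if S: "S \<in> L" and "i' \<noteq> i" for i S i'
  proof -
    let ?c = "Min ({..<k} - S)"
    have card_compl: "card ({..<k} - S) = k div 2"
      using S finite_subset[of S "{..<k}"] by (simp add: L_def m_def card_Diff_subset)
    then have "card ({..<k} - S) \<noteq> 0" using k by simp
    then have "{..<k} - S \<noteq> {}" by (metis card.empty)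
    then have c: "?c \<in> {..<k} - S" by (intro Min_in) auto
    have "positions k (w (i, S)) i' \<subseteq> (if i' = a i then {?c} else {..<k} - S - {?c})"
      using \<open>i' \<noteq> i\<close> ab[of i] by (auto simp: positions_def w_def split: if_splits)
    then have "card (positions k (w (i, S)) i') \<le> card (if i' = a i then {?c} else {..<k} - S - {?c})"
      by (intro card_mono) auto
    \<comment> \<open>Splitting the \<open>k div 2\<close> free positions between two letters keeps
      both counts below \<open>m\<close>: \<open>k\<close> \<ge> 3 gives \<open>m\<close> \<ge> 2,
      and \<open>m\<close> is at least \<open>k div 2\<close>.\<close>
    also have "\<dots> \<le> max 1 (k div 2 - 1)"
      using c card_compl by (simp add: card_Diff_singleton)
    also have "\<dots> < m" using k by (auto simp: m_def)
    finally show ?thesis .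
  qed
  have "solving_words k r ({..<r} \<times> L) w"
    unfolding solving_words_def
  proof (intro conjI ballI)
    fix x assume "x \<in> {..<r} \<times> L"
    then show "\<forall>j<k. w x j < r" using ab by (auto simp: w_def)
  next
    fix d assume "d \<in> {..<r} \<times> L"
    then obtain i S where d: "d = (i, S)" "i < r" "S \<in> L" by blast
    \<comment> \<open>Only words with main letter \<open>i\<close> contain \<open>i\<close> as often
      as \<open>m\<close> times; among these, sets of equal size are compared.\<close>
    have "x = d" if x: "x \<in> {..<r} \<times> L" and sub: "S \<subseteq> positions k (w x) i" for x
    proof -
      obtain i' S' where x': "x = (i', S')" "S' \<in> L" using x by blast
      have "card S \<le> card (positions k (w x) i)"
        using sub finite_subset[OF positions_subset] by (intro card_mono) auto
      then have i: "i' = i" using small[OF x'(2), of i i'] x' d(3) by (force simp: L_def)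
      then have "S \<subseteq> S'" using sub own x' by simp
      then have "S = S'"
        using x'(2) d(3) finite_subset[of S' "{..<k}"] by (intro card_subset_eq) (auto simp: L_def)
      then show ?thesis using i x' d by simp
    qed
    then have "identifies k ({..<r} \<times> L) w d i"
      unfolding identifies_def using own d by simp
    then show "\<exists>i<r. identifies k ({..<r} \<times> L) w d i" using d(2) by blast
  qed
  moreover have "finite L" unfolding L_def by (rule finite_subset[of _ "Pow {..<k}"]) auto
  moreover have "card L = k choose (k div 2)"
    using binomial_symmetric[of "k div 2" k] by (simp add: L_def n_subsets m_def)
  ultimately show ?thesis
    using solving_words_imp_solvable2[of "{..<r} \<times> L" k r w] by (simp add: card_cartesian_product)
qed

lemma two_queries_solvable:
  assumes r: "1 \<le> r"
  shows "solvable2 2 r (2 * r - 1)"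
proof -
  define Y :: "(nat \<times> nat) set" where "Y = {..<r} \<times> {0} \<union> {0} \<times> {1..<r}"
  define w :: "nat \<times> nat \<Rightarrow> nat \<Rightarrow> nat" where "w = (\<lambda>(a, b) j. if j = 0 then a else b)"
  have "solving_words 2 r Y w"
    unfolding solving_words_def
  proof (intro conjI ballI)
    fix x assume "x \<in> Y"
    then show "\<forall>j<2. w x j < r" using r by (auto simp: Y_def w_def)
  next
    fix d assume d: "d \<in> Y"
    \<comment> \<open>The maximum selects the nonzero letter if there is one, which no other word
      has at the same position; for the word (0,0) it selects 0, which no other word has at both
      positions.\<close>
    have "identifies 2 Y w d (max (fst d) (snd d))"
      using d unfolding identifies_def positions_2_subset_iff by (auto simp: Y_def w_def)
    moreover have "max (fst d) (snd d) < r" using d r by (auto simp: Y_def)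
    ultimately show "\<exists>i<r. identifies 2 Y w d i" by blast
  qed
  moreover have "card Y = 2 * r - 1"
    unfolding Y_def by (subst card_Un_disjoint) (use r in \<open>auto simp: card_cartesian_product\<close>)
  moreover have "finite Y" by (simp add: Y_def)
  ultimately show ?thesis using solving_words_imp_solvable2 by metis
qed

lemma g2_eqI:
  assumes "solvable2 k r N"
    and "\<And>(X :: nat set) w. finite X \<Longrightarrow> solving_words k r X w \<Longrightarrow> card X \<le> N"
  shows "g2 k r = N"
proof (rule antisym)
  show "g2 k r \<le> N" using solvable2_obtain_words[OF solvable2_g2] assms(2) by metis
  show "N \<le> g2 k r" by (rule solvable2_le_g2[OF assms(1)])
qed

theorem theorem2:
  fixes k r :: nat
  assumes "k \<ge> 1" and "r \<ge> 2"
  shows "(k \<ge> 3 \<and> r \<noteq> 2 \<longrightarrow> g2 k r = r * (k choose (k div 2))) \<and>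
         (r = 2 \<longrightarrow> g2 k r = (k choose (k div 2)) + (k choose (k div 2 + 1))) \<and>
         (k = 2 \<longrightarrow> g2 k r = 2 * r - 1)"
proof (intro conjI impI)
  assume "k \<ge> 3 \<and> r \<noteq> 2"
  then show "g2 k r = r * (k choose (k div 2))"
    using assms by (intro g2_eqI many_letters_solvable solving_words_card_le) auto
next
  assume "r = 2"
  then show "g2 k r = (k choose (k div 2)) + (k choose (k div 2 + 1))"
    using assms two_letters_solvable solving_words_two_letters_card_le by (intro g2_eqI) auto
next
  assume "k = 2"
  then show "g2 k r = 2 * r - 1"
    using assms two_queries_solvable[of r] solving_words_two_queries_card_le[of _ r]
    by (intro g2_eqI) auto
qed

end
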